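(* Let $F_k:\mathbb{R}^n\to\mathcal{I}$ ($k=1,\dots,m$) be interval-valued functions, $g_j:\mathbb{R}^n\to\mathbb{R}$ ($j=1,\dots,p$) functions, $F=(F_1,\dots,F_m)$, and $S:=\{u\in\mathbb{R}^n: g_j(u)\le 0,\ j=1,\dots,p\}$. Let $\varepsilon\in\mathbb{R}^m_+\setminus\{0\}$. Then $M(F,S,\varepsilon)\neq\emptyset$.
   Context: $\mathcal{I}$ is the set of all compact intervals $[\underline q,\overline q]$ with $\underline q\le\overline q$ real. For $Q=[\underline q,\overline q]\in\mathcal I$ put $q^c=\frac{\underline q+\overline q}{2}$ and $q^w=\frac{\overline q-\underline q}{2}$. Addition: $[\underline q,\overline q]+[\underline r,\overline r]=[\underline q+\underline r,\overline q+\overline r]$. Order: for $Q=[\underline q,\overline q]$ and $R=[\underline r,\overline r]$ in $\mathcal I$, $Q\prec_{CW}R$ iff $q^c<r^c$ and $q^w<r^w$. $\mathbb{R}^m_+$ is the nonnegative orthant of $\mathbb{R}^m$. For $\varepsilon=(\varepsilon_1,\dots,\varepsilon_m)\in\mathbb{R}^m_+$, $M(F,S,\varepsilon)$ (the set of weak $\varepsilon$-minimal solutions of the problem of minimizing $F$ over $S$) is the set of all $z_0\in S$ for which there is no $z\in S$ with $F_k(z)+[0,\varepsilon_k]\prec_{CW}F_k(z_0)$ for all $k=1,\dots,m$.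
   Formalization: The feasible set S is additionally assumed to be nonempty; without this the claim is false (e.g. p = 1 and g_1 = 1 give S = ∅, so M(F,S,ε) = ∅). *)

theory Defs
  imports "HOL-Analysis.Analysis" "HOL-Library.Interval"
begin

definition ivl_center :: "real interval \<Rightarrow> real" where
  "ivl_center Q = (lower Q + upper Q) / 2"

definition ivl_halfwidth :: "real interval \<Rightarrow> real" where
  "ivl_halfwidth Q = (upper Q - lower Q) / 2"

definition prec_CW :: "real interval \<Rightarrow> real interval \<Rightarrow> bool"  (infix \<open>\<prec>\<^sub>C\<^sub>W\<close> 50) where
  "Q \<prec>\<^sub>C\<^sub>W R \<longleftrightarrow> ivl_center Q < ivl_center R \<and> ivl_halfwidth Q < ivl_halfwidth R"

definition feasible_set :: "nat \<Rightarrow> (nat \<Rightarrow> real ^ 'n \<Rightarrow> real) \<Rightarrow> (real ^ 'n) set" where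
  "feasible_set p g = {u. \<forall>j\<in>{1..p}. g j u \<le> 0}"

(* Meaningful only for componentwise nonnegative \<epsilon>: Interval (0, \<epsilon> $ k) is the interval from 0
   to \<epsilon> $ k if 0 \<le> \<epsilon> $ k and unspecified otherwise. *)
definition weak_eps_minimal ::
    "(real ^ 'n \<Rightarrow> real interval ^ 'm) \<Rightarrow> (real ^ 'n) set \<Rightarrow> real ^ 'm \<Rightarrow> (real ^ 'n) set" where
  "weak_eps_minimal F S \<epsilon> =
    {z0 \<in> S. \<not> (\<exists>z\<in>S. \<forall>k. F z $ k + Interval (0, \<epsilon> $ k) \<prec>\<^sub>C\<^sub>W F z0 $ k)}"

end

theory Submission
  imports Defs
begin

text \<open>
  Half-widths are nonnegative, and adding \<open>[0, e]\<close> raises the half-width by \<open>e / 2\<close>. For an index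
  \<open>k\<close> with \<open>\<epsilon>\<^sub>k > 0\<close>, any feasible point whose half-width of \<open>F\<^sub>k\<close> is within \<open>\<epsilon>\<^sub>k / 2\<close> of the
  infimum over the feasible set is therefore weakly \<open>\<epsilon>\<close>-minimal.
\<close>

lemma ivl_halfwidth_nonneg: "0 \<le> ivl_halfwidth Q"
  by (simp add: ivl_halfwidth_def)

text \<open>For \<open>e < 0\<close> the term \<open>Interval (0, e)\<close> is unspecified;
  \<open>0 \<le> e\<close> lets \<open>Interval_inverse\<close> compute its bounds.\<close>

lemma ivl_halfwidth_add_Interval:
  assumes "0 \<le> e"
  shows "ivl_halfwidth (Q + Interval (0, e)) = ivl_halfwidth Q + e / 2"
  using assms
  by (simp add: ivl_halfwidth_def lower.rep_eq[of "Interval _"] upper.rep_eq[of "Interval _"]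
      Interval_inverse field_simps)

text \<open>The infimum need not be attained, but since \<open>d > 0\<close>, raising it by
  \<open>d\<close> gives a number that is no longer a lower bound.\<close>

lemma exists_near_infimum:
  fixes f :: "'a \<Rightarrow> real"
  assumes "S \<noteq> {}" and "bdd_below (f ` S)" and "0 < d"
  obtains z0 where "z0 \<in> S" and "\<And>z. z \<in> S \<Longrightarrow> f z0 < f z + d"
proof -
  have "(INF z\<in>S. f z) < (INF z\<in>S. f z) + d"
    using assms(3) by simp
  then obtain z0 where z0: "z0 \<in> S" "f z0 < (INF z\<in>S. f z) + d"
    using cINF_less_iff[OF assms(1,2)] by blast
  have "f z0 < f z + d" if "z \<in> S" for z
    using z0(2) cINF_lower[OF assms(2) that] by linarith
  with z0(1) show thesis by (rule that)
qed

theorem theorem3p1: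
  fixes F :: "real ^ 'n \<Rightarrow> real interval ^ 'm"
    and g :: "nat \<Rightarrow> real ^ 'n \<Rightarrow> real"
    and p :: nat
    and \<epsilon> :: "real ^ 'm"
  assumes "feasible_set p g \<noteq> {}"
    and "\<forall>k. 0 \<le> \<epsilon> $ k"
    and "\<epsilon> \<noteq> 0"
  shows "weak_eps_minimal F (feasible_set p g) \<epsilon> \<noteq> {}"
proof -
  let ?S = "feasible_set p g"
  obtain k where "\<epsilon> $ k \<noteq> 0"
    using assms(3) by (auto simp: vec_eq_iff)
  with assms(2) have k: "0 < \<epsilon> $ k"
    by (simp add: order_less_le)
  have "bdd_below ((\<lambda>z. ivl_halfwidth (F z $ k)) ` ?S)"
    by (rule bdd_belowI[of _ 0]) (auto simp: ivl_halfwidth_nonneg)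
  then obtain z0 where z0: "z0 \<in> ?S"
      "\<And>z. z \<in> ?S \<Longrightarrow> ivl_halfwidth (F z0 $ k) < ivl_halfwidth (F z $ k) + \<epsilon> $ k / 2"
    using exists_near_infimum[OF assms(1), of _ "\<epsilon> $ k / 2"] k by auto
  \<comment> \<open>Domination is required in every component, so it is enough to refute it at
    \<open>k\<close>, where the half-width inequality fails.\<close>
  have "\<not> F z $ k + Interval (0, \<epsilon> $ k) \<prec>\<^sub>C\<^sub>W F z0 $ k" if "z \<in> ?S" for z
    using z0(2)[OF that] k by (simp add: prec_CW_def ivl_halfwidth_add_Interval)
  with z0(1) have "z0 \<in> weak_eps_minimal F ?S \<epsilon>"
    by (auto simp: weak_eps_minimal_def)
  then show ?thesis by blast
qed

end
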